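(* Let $\Omega\subset\mathbf{R}^n$ be a non-empty bounded open set, and let $S:\mathcal{L}_2(\Omega)\times W_2^1(\Omega)\to W_2^1(\Omega)$ be the solution map of Dirichlet's problem. If $f\in\mathcal{L}_2(\Omega)$, $g,\tilde g\in W_2^1(\Omega)$ and $g-\tilde g\in\mathring{W}_2^1(\Omega)$, then $S(f,g)=S(f,\tilde g)$.
   Context: All functions are real-valued. $\mathcal{L}_2(\Omega)$ is the Lebesgue space of square-integrable functions on $\Omega$ (modulo null sets), with scalar product $(u|v)_2=\int_\Omega uv$. $W_2^1(\Omega)$ is the Sobolev space of functions in $\mathcal{L}_2(\Omega)$ whose first-order weak partial derivatives are in $\mathcal{L}_2(\Omega)$. For $u,v\in W_2^1(\Omega)$ put $(u|v)_\nabla=\int_\Omega\sum_{i=1}^n\partial_iu\,\partial_iv$ and $\|u\|_\nabla^2=(u|u)_\nabla$; the scalar product of $W_2^1(\Omega)$ is $(\cdot|\cdot)_{1,2}=(\cdot|\cdot)_2+(\cdot|\cdot)_\nabla$, with norm $\|\cdot\|_{1,2}$. $\mathring{W}_2^1(\Omega)$ is, as usual, the closed subspace of $W_2^1(\Omega)$ of functions vanishing on the border, i.e. the closure of $C_c^\infty(\Omega)$ in $W_2^1(\Omega)$. Solution map: for $f\in\mathcal{L}_2(\Omega)$ and $g\in W_2^1(\Omega)$, Dirichlet's principle says there is a unique $u\in W_2^1(\Omega)$ with $u-g\in\mathring{W}_2^1(\Omega)$ that minimizes $w\mapsto\frac12\|w\|_\nabla^2-(f|w)_2$ over all $w\in W_2^1(\Omega)$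 with $w-g\in\mathring{W}_2^1(\Omega)$; equivalently, it is the unique $u\in W_2^1(\Omega)$ with $u-g\in\mathring{W}_2^1(\Omega)$ and $(u|\phi)_\nabla=(f|\phi)_2$ for all $\phi\in\mathring{W}_2^1(\Omega)$. This $u$ is denoted $S(f,g)$. *)

theory Defs
  imports "HOL-Analysis.Analysis"
begin

section \<open>Test functions\<close>

definition pd :: "'n::finite \<Rightarrow> (real^'n \<Rightarrow> real) \<Rightarrow> real^'n \<Rightarrow> real" where
  "pd i \<phi> x = frechet_derivative \<phi> (at x) (axis i 1)"

primrec C_k :: "nat \<Rightarrow> (real^'n::finite \<Rightarrow> real) \<Rightarrow> bool" where
  "C_k 0 \<phi> \<longleftrightarrow> continuous_on UNIV \<phi>"
| "C_k (Suc k) \<phi> \<longleftrightarrow> \<phi> differentiable_on UNIV \<and> (\<forall>i. C_k k (pd i \<phi>))"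

text \<open>Elements of \<open>C\<^sub>c\<^sup>\<infinity>(\<Omega>)\<close> are extended by zero to the whole space, where they are again smooth.\<close>

definition test_functions :: "(real^'n::finite) set \<Rightarrow> (real^'n \<Rightarrow> real) set" where
  "test_functions \<Omega> =
     {\<phi>. (\<forall>k. C_k k \<phi>) \<and> compact (closure {x. \<phi> x \<noteq> 0}) \<and> closure {x. \<phi> x \<noteq> 0} \<subseteq> \<Omega>}"

section \<open>Functions modulo null sets\<close>

definition ae_rel :: "(real^'n::finite) set \<Rightarrow> (real^'n \<Rightarrow> real) rel" where
  "ae_rel \<Omega> = {(u, v). u \<in> borel_measurable (lebesgue_on \<Omega>) \<and>
     v \<in> borel_measurable (lebesgue_on \<Omega>) \<and> (AE x in lebesgue_on \<Omega>. u x = v x)}"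

definition cls :: "(real^'n::finite) set \<Rightarrow> (real^'n \<Rightarrow> real) \<Rightarrow> (real^'n \<Rightarrow> real) set" where
  "cls \<Omega> u = ae_rel \<Omega> `` {u}"

text \<open>Everything below that is defined through \<open>rep\<close> depends on the equivalence class only:
  values of a representative on null sets and outside \<open>\<Omega>\<close> are irrelevant.\<close>

definition rep :: "(real^'n::finite \<Rightarrow> real) set \<Rightarrow> real^'n \<Rightarrow> real" where
  "rep U = (SOME u. u \<in> U)"

definition cdiff :: "(real^'n::finite) set \<Rightarrow>
    (real^'n \<Rightarrow> real) set \<Rightarrow> (real^'n \<Rightarrow> real) set \<Rightarrow> (real^'n \<Rightarrow> real) set" where
  "cdiff \<Omega> U V = cls \<Omega> (\<lambda>x. rep U x - rep V x)"

definition L2 :: "(real^'n::finite) set \<Rightarrow> (real^'n \<Rightarrow> real) set set" where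
  "L2 \<Omega> = {u \<in> borel_measurable (lebesgue_on \<Omega>). integrable (lebesgue_on \<Omega>) (\<lambda>x. (u x)\<^sup>2)} // ae_rel \<Omega>"

definition inner_L2 :: "(real^'n::finite) set \<Rightarrow>
    (real^'n \<Rightarrow> real) set \<Rightarrow> (real^'n \<Rightarrow> real) set \<Rightarrow> real" where
  "inner_L2 \<Omega> U V = (LINT x|lebesgue_on \<Omega>. rep U x * rep V x)"

section \<open>Sobolev spaces\<close>

definition is_weak_pd :: "(real^'n::finite) set \<Rightarrow> 'n \<Rightarrow>
    (real^'n \<Rightarrow> real) set \<Rightarrow> (real^'n \<Rightarrow> real) set \<Rightarrow> bool" where
  "is_weak_pd \<Omega> i U V \<longleftrightarrow> (\<forall>\<phi>\<in>test_functions \<Omega>.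
     (LINT x|lebesgue_on \<Omega>. rep U x * pd i \<phi> x) = - (LINT x|lebesgue_on \<Omega>. rep V x * \<phi> x))"

definition W21 :: "(real^'n::finite) set \<Rightarrow> (real^'n \<Rightarrow> real) set set" where
  "W21 \<Omega> = {U \<in> L2 \<Omega>. \<forall>i. \<exists>V\<in>L2 \<Omega>. is_weak_pd \<Omega> i U V}"

definition weak_pd :: "(real^'n::finite) set \<Rightarrow> 'n \<Rightarrow>
    (real^'n \<Rightarrow> real) set \<Rightarrow> (real^'n \<Rightarrow> real) set" where
  "weak_pd \<Omega> i U = (THE V. V \<in> L2 \<Omega> \<and> is_weak_pd \<Omega> i U V)"

definition inner_nabla :: "(real^'n::finite) set \<Rightarrow>
    (real^'n \<Rightarrow> real) set \<Rightarrow> (real^'n \<Rightarrow> real) set \<Rightarrow> real" where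
  "inner_nabla \<Omega> U V =
     (LINT x|lebesgue_on \<Omega>. (\<Sum>i\<in>UNIV. rep (weak_pd \<Omega> i U) x * rep (weak_pd \<Omega> i V) x))"

definition norm_nabla :: "(real^'n::finite) set \<Rightarrow> (real^'n \<Rightarrow> real) set \<Rightarrow> real" where
  "norm_nabla \<Omega> U = sqrt (inner_nabla \<Omega> U U)"

definition inner_12 :: "(real^'n::finite) set \<Rightarrow>
    (real^'n \<Rightarrow> real) set \<Rightarrow> (real^'n \<Rightarrow> real) set \<Rightarrow> real" where
  "inner_12 \<Omega> U V = inner_L2 \<Omega> U V + inner_nabla \<Omega> U V"

definition norm_12 :: "(real^'n::finite) set \<Rightarrow> (real^'n \<Rightarrow> real) set \<Rightarrow> real" where
  "norm_12 \<Omega> U = sqrt (inner_12 \<Omega> U U)"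

text \<open>Closure of \<open>C\<^sub>c\<^sup>\<infinity>(\<Omega>)\<close> in \<open>W21 \<Omega>\<close> with respect to \<open>norm_12 \<Omega>\<close>.\<close>

definition W21_0 :: "(real^'n::finite) set \<Rightarrow> (real^'n \<Rightarrow> real) set set" where
  "W21_0 \<Omega> = {U \<in> W21 \<Omega>. \<forall>e>0. \<exists>\<phi>\<in>test_functions \<Omega>. norm_12 \<Omega> (cdiff \<Omega> U (cls \<Omega> \<phi>)) < e}"

section \<open>The solution map of Dirichlet's problem\<close>

definition dirichlet_energy :: "(real^'n::finite) set \<Rightarrow>
    (real^'n \<Rightarrow> real) set \<Rightarrow> (real^'n \<Rightarrow> real) set \<Rightarrow> real" where
  "dirichlet_energy \<Omega> F W = (norm_nabla \<Omega> W)\<^sup>2 / 2 - inner_L2 \<Omega> F W"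

text \<open>The description denotes by Dirichlet's principle when \<open>\<Omega>\<close> is open, bounded and non-empty,
  \<open>F \<in> L2 \<Omega>\<close> and \<open>G \<in> W21 \<Omega>\<close>.\<close>

definition solution_map :: "(real^'n::finite) set \<Rightarrow>
    (real^'n \<Rightarrow> real) set \<Rightarrow> (real^'n \<Rightarrow> real) set \<Rightarrow> (real^'n \<Rightarrow> real) set" where
  "solution_map \<Omega> F G =
     (THE U. is_arg_min (dirichlet_energy \<Omega> F) (\<lambda>W. W \<in> W21 \<Omega> \<and> cdiff \<Omega> W G \<in> W21_0 \<Omega>) U)"

end

theory Submission
  imports Defs "HOL-Computational_Algebra.Polynomial"
begin

text \<open>The data \<open>g\<close> enters the solution map only through the set of admissible \<open>W\<close>, those with
  \<open>W - g\<close> in \<open>W21_0 \<Omega>\<close>. As \<open>W21_0 \<Omega>\<close> is closed under differences and contains \<open>g - g'\<close>,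
  the admissible sets of \<open>g\<close> and \<open>g'\<close> coincide.

  Closure under differences requires that \<open>norm_12 \<Omega>\<close> satisfies some form of the triangle inequality,
  hence that \<open>weak_pd \<Omega> i\<close> is well defined and linear. Uniqueness of weak derivatives is the
  fundamental lemma of the calculus of variations: smooth bump functions approximate the indicators
  of boxes, so a function orthogonal to all test functions has vanishing integral over every small
  box, and it vanishes almost everywhere by Lebesgue differentiation. That test functions have weak
  derivatives is integration by parts; the integral of a derivative is the limit of
  integrals of difference quotients, which are zero by translation invariance.\<close>

section \<open>Differentiability classes\<close>

lemma pd_eq: "(\<phi> has_derivative D) (at x) \<Longrightarrow> pd i \<phi> x = D (axis i 1)"
  unfolding pd_def by (metis frechet_derivative_at)

text \<open>The class is lowered by passing the claim to the partial derivatives, down to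
  differentiability implying continuity. The product rule needs this, as undifferentiated factors
  stand there beside derivatives of lower class.\<close>

lemma C_k_SucD: "C_k (Suc k) \<phi> \<Longrightarrow> C_k k \<phi>"
proof (induction k arbitrary: \<phi>)
  case 0
  then show ?case by (simp add: differentiable_imp_continuous_on)
qed (metis C_k.simps(2))

lemma C_k_const: "C_k k (\<lambda>x :: real^'n::finite. c)"
proof (induction k arbitrary: c)
  case (Suc k)
  have "pd i (\<lambda>x :: real^'n. c) = (\<lambda>x. 0)" for i by (auto simp: pd_def)
  then show ?case using Suc by simp
qed simp

lemma pd_add:
  "\<phi> differentiable at x \<Longrightarrow> \<psi> differentiable at x \<Longrightarrow> pd i (\<lambda>x. \<phi> x + \<psi> x) x = pd i \<phi> x + pd i \<psi> x"
  unfolding frechet_derivative_works by (rule pd_eq[THEN trans]) (auto intro: has_derivative_add simp: pd_def)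

lemma pd_mult:
  "\<phi> differentiable at x \<Longrightarrow> \<psi> differentiable at x \<Longrightarrow>
    pd i (\<lambda>x. \<phi> x * \<psi> x) x = \<phi> x * pd i \<psi> x + pd i \<phi> x * \<psi> x"
  unfolding frechet_derivative_works by (rule pd_eq[THEN trans]) (auto intro: has_derivative_mult simp: pd_def)

lemma C_k_add: "C_k k \<phi> \<Longrightarrow> C_k k \<psi> \<Longrightarrow> C_k k (\<lambda>x. \<phi> x + \<psi> x)"
proof (induction k arbitrary: \<phi> \<psi>)
  case 0
  then show ?case by (simp add: continuous_on_add)
next
  case (Suc k)
  have "pd i (\<lambda>x. \<phi> x + \<psi> x) = (\<lambda>x. pd i \<phi> x + pd i \<psi> x)" for i
    using Suc.prems by (intro ext pd_add) (simp_all add: differentiable_on_def)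
  then show ?case using Suc by (simp add: differentiable_on_def)
qed

lemma C_k_mult: "C_k k \<phi> \<Longrightarrow> C_k k \<psi> \<Longrightarrow> C_k k (\<lambda>x. \<phi> x * \<psi> x)"
proof (induction k arbitrary: \<phi> \<psi>)
  case 0
  then show ?case by (simp add: continuous_on_mult)
next
  case (Suc k)
  have "pd i (\<lambda>x. \<phi> x * \<psi> x) = (\<lambda>x. \<phi> x * pd i \<psi> x + pd i \<phi> x * \<psi> x)" for i
    using Suc.prems by (intro ext pd_mult) (simp_all add: differentiable_on_def)
  moreover have "C_k k \<phi>" "C_k k \<psi>" using Suc.prems by (auto intro: C_k_SucD simp del: C_k.simps)
  ultimately show ?case using Suc by (auto simp: differentiable_on_def intro!: C_k_add)
qed

lemma C_k_prod: "(\<And>i. i \<in> A \<Longrightarrow> C_k k (f i)) \<Longrightarrow> C_k k (\<lambda>x. \<Prod>i\<in>A. f i x)"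
  by (induction A rule: infinite_finite_induct) (auto intro: C_k_const C_k_mult)

text \<open>A whole tower \<open>D\<close> of successive derivatives is given because the partial
  derivatives of the function built from \<open>D m\<close> are constant multiples of the one built
  from \<open>D (Suc m)\<close>. The induction on \<open>k\<close> therefore runs over all
  \<open>m\<close> at once.\<close>

lemma C_k_compose_coordinate:
  assumes D: "\<And>m t. (D m has_real_derivative D (Suc m) t) (at t)"
  shows "C_k k (\<lambda>x :: real^'n::finite. D m (c * x $ i + b))"
proof (induction k arbitrary: m)
  case 0
  have "continuous_on UNIV (D m)" using D by (metis DERIV_continuous_on has_field_derivative_at_within)
  then have "continuous_on UNIV (\<lambda>x :: real^'n. D m (c * x $ i + b))"
    by (rule continuous_on_compose2) (auto intro!: continuous_intros)
  then show ?case by simp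
next
  case (Suc k)
  have der: "((\<lambda>x :: real^'n. D m (c * x $ i + b)) has_derivative
      (\<lambda>h. D (Suc m) (c * x $ i + b) * (c * h $ i))) (at x)" for x
  proof (rule has_derivative_compose[where g = "D m" and g' = "(*) (D (Suc m) (c * x $ i + b))"])
    show "((\<lambda>x :: real^'n. c * x $ i + b) has_derivative (\<lambda>h. c * h $ i)) (at x)"
      by (auto intro!: derivative_eq_intros bounded_linear_imp_has_derivative bounded_linear_vec_nth)
    show "(D m has_derivative (*) (D (Suc m) (c * x $ i + b))) (at (c * x $ i + b))"
      using D by (simp add: has_field_derivative_def)
  qed
  have "pd j (\<lambda>x :: real^'n. D m (c * x $ i + b)) = (\<lambda>x. D (Suc m) (c * x $ i + b) * (c * axis j 1 $ i))" for j
    using pd_eq[OF der] by auto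
  then show ?case using Suc der by (auto simp: differentiable_on_def differentiable_def intro!: C_k_mult C_k_const)
qed

section \<open>Smooth bump functions\<close>

text \<open>For \<open>p = 1\<close> this is the classical function exp(-1/t), smooth and flat at 0.
  The polynomial factor in 1/t makes the family closed under differentiation.\<close>

definition exp_inv :: "real poly \<Rightarrow> real \<Rightarrow> real" where
  "exp_inv p t = (if t > 0 then poly p (1 / t) * exp (- (1 / t)) else 0)"

text \<open>Splitting off the constant coefficient of \<open>p\<close> leaves a factor
  \<open>t\<close>, which raises \<open>k\<close> by one; hence the general power in the
  statement.\<close>

lemma poly_times_exp_minus_tendsto_0: "((\<lambda>t :: real. t ^ k * poly p t * exp (- t)) \<longlongrightarrow> 0) at_top"
proof (induction p arbitrary: k)
  case (pCons a p)
  have "((\<lambda>t. a * (t ^ k / exp t) + t ^ Suc k * poly p t * exp (- t)) \<longlongrightarrow> a * 0 + 0) at_top"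
    by (intro tendsto_intros tendsto_power_div_exp_0 pCons.IH)
  then show ?case by (simp add: algebra_simps exp_minus divide_inverse)
qed simp

text \<open>With s = 1/t one has ds/dt = -s^2, so p(s) exp(-s) has the t-derivative s^2 (p(s) -
  p'(s)) exp(-s); \<open>[:0, 0, 1:]\<close> is the polynomial s^2.\<close>

lemma has_derivative_exp_inv:
  "(exp_inv p has_real_derivative exp_inv ([:0, 0, 1:] * (p - pderiv p)) t) (at t)"
proof -
  consider "t > 0" | "t < 0" | "t = 0" by linarith
  then show ?thesis
  proof cases
    case 1
    have "((\<lambda>t. poly p (1 / t) * exp (- (1 / t))) has_real_derivative
        exp_inv ([:0, 0, 1:] * (p - pderiv p)) t) (at t)"
      using 1 by (auto intro!: derivative_eq_intros DERIV_chain2[OF poly_DERIV]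
          simp: exp_inv_def field_simps power2_eq_square)
    then show ?thesis
      by (rule has_field_derivative_transform_within_open[of _ _ _ "{0<..}"]) (use 1 in \<open>auto simp: exp_inv_def\<close>)
  next
    case 2
    have "((\<lambda>t. 0) has_real_derivative exp_inv ([:0, 0, 1:] * (p - pderiv p)) t) (at t)"
      using 2 by (auto simp: exp_inv_def)
    then show ?thesis
      by (rule has_field_derivative_transform_within_open[of _ _ _ "{..<0}"]) (use 2 in \<open>auto simp: exp_inv_def\<close>)
  next
    case 3
    \<comment> \<open>From the right, the substitution s = 1/h turns the difference quotient at 0
      into s p(s) exp(-s), which tends to 0 as s grows.\<close>
    have "((\<lambda>h. exp_inv p h / h) \<longlongrightarrow> 0) (at_right 0)"
    proof (rule Lim_transform_eventually)
      show "((\<lambda>h. inverse h ^ 1 * poly p (inverse h) * exp (- inverse h)) \<longlongrightarrow> 0) (at_right (0::real))"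
        by (rule filterlim_compose[OF poly_times_exp_minus_tendsto_0 filterlim_inverse_at_top_right])
      show "\<forall>\<^sub>F h in at_right 0. inverse h ^ 1 * poly p (inverse h) * exp (- inverse h) = exp_inv p h / h"
        using eventually_at_right_less[of "0::real"]
        by eventually_elim (simp add: exp_inv_def divide_inverse)
    qed
    moreover have "((\<lambda>h. exp_inv p h / h) \<longlongrightarrow> 0) (at_left 0)"
      by (rule Lim_transform_eventually[OF tendsto_const])
        (auto simp: exp_inv_def eventually_at_left_field intro: exI[of _ "-1"])
    ultimately have "((\<lambda>h. exp_inv p h / h) \<longlongrightarrow> 0) (at 0)"
      by (simp add: filterlim_split_at)
    then show ?thesis using 3 by (simp add: DERIV_def exp_inv_def)
  qed
qed

text \<open>The scaling by \<open>m + 1\<close> makes these functions increase to the indicator of \<open>box a b\<close>.\<close>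

definition bump :: "real^'n::finite \<Rightarrow> real^'n \<Rightarrow> nat \<Rightarrow> real^'n \<Rightarrow> real" where
  "bump a b m x = (\<Prod>i\<in>UNIV. exp_inv 1 (real (Suc m) * x $ i + - (real (Suc m) * a $ i)) *
     exp_inv 1 (- real (Suc m) * x $ i + real (Suc m) * b $ i))"

lemma C_k_exp_inv: "C_k k (\<lambda>x :: real^'n::finite. exp_inv 1 (c * x $ i + d))"
  \<comment> \<open>The tower consists of the iterates of p \<mapsto> s^2 (p - p'), started at the
    constant polynomial 1.\<close>
  using C_k_compose_coordinate[of "\<lambda>m. exp_inv (((\<lambda>p. [:0, 0, 1:] * (p - pderiv p)) ^^ m) 1)" k 0 c i d]
    has_derivative_exp_inv by simp

lemma exp_inv_1_nonneg: "exp_inv 1 t \<ge> 0"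
  and exp_inv_1_le_1: "exp_inv 1 t \<le> 1"
  by (auto simp: exp_inv_def)

lemma exp_inv_1_scaled_tendsto:
  "(\<lambda>m. exp_inv 1 (real (Suc m) * t)) \<longlonglongrightarrow> (if t > 0 then 1 else 0)"
proof (cases "t > 0")
  case True
  have "(\<lambda>m. exp (- (inverse (real (Suc m)) * (1 / t)))) \<longlonglongrightarrow> exp (- (0 * (1 / t)))"
    by (intro tendsto_intros LIMSEQ_inverse_real_of_nat)
  then show ?thesis using True by (simp add: exp_inv_def field_simps del: of_nat_Suc)
next
  case False
  then have "\<not> real (Suc m) * t > 0" for m by (simp add: zero_less_mult_iff del: of_nat_Suc)
  then show ?thesis using False by (simp add: exp_inv_def del: of_nat_Suc)
qed

lemma bump_bounds: "0 \<le> bump a b m x" "bump a b m x \<le> 1"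
  unfolding bump_def
  by (auto intro!: prod_nonneg prod_le_1 mult_nonneg_nonneg mult_le_one exp_inv_1_nonneg exp_inv_1_le_1)

text \<open>Each factor is nonzero exactly on one open half-space, and the box is the intersection
  of these half-spaces.\<close>

lemma bump_nonzero_iff: "bump a b m x \<noteq> 0 \<longleftrightarrow> x \<in> box a b"
proof -
  have "exp_inv 1 t \<noteq> 0 \<longleftrightarrow> t > 0" for t by (auto simp: exp_inv_def)
  moreover have "real (Suc m) * x $ i + - (real (Suc m) * a $ i) = real (Suc m) * (x $ i - a $ i)"
      "- real (Suc m) * x $ i + real (Suc m) * b $ i = real (Suc m) * (b $ i - x $ i)" for i
    by (simp_all add: algebra_simps)
  ultimately show ?thesis
    by (simp add: bump_def mem_box_cart zero_less_mult_iff del: of_nat_Suc)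
qed

text \<open>Every factor tends to the indicator of its open half-space, and a product of indicators
  is the indicator of the intersection.\<close>

lemma bump_tendsto_indicator: "(\<lambda>m. bump a b m x) \<longlonglongrightarrow> indicator (box a b) x"
proof -
  have e: "real (Suc m) * x $ i + - (real (Suc m) * a $ i) = real (Suc m) * (x $ i - a $ i)"
      "- real (Suc m) * x $ i + real (Suc m) * b $ i = real (Suc m) * (b $ i - x $ i)" for i m
    by (simp_all add: algebra_simps)
  have "(\<lambda>m. bump a b m x) \<longlonglongrightarrow>
      (\<Prod>i\<in>UNIV. (if x $ i - a $ i > 0 then 1 else 0) * (if b $ i - x $ i > 0 then 1 else 0))"
    unfolding bump_def e by (intro tendsto_prod tendsto_mult exp_inv_1_scaled_tendsto)
  also have "(\<Prod>i\<in>UNIV. (if x $ i - a $ i > 0 then 1 else 0) * (if b $ i - x $ i > 0 then 1 else 0)) =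
      (indicator (box a b) x :: real)"
    by (auto simp: indicator_def mem_box_cart intro!: prod.neutral prod_zero)
  finally show ?thesis .
qed

lemma bump_test_function:
  assumes "cbox a b \<subseteq> \<Omega>"
  shows "bump a b m \<in> test_functions \<Omega>"
proof -
  have "C_k k (bump a b m)" for k
    unfolding bump_def by (intro C_k_prod C_k_mult C_k_exp_inv)
  moreover have sub: "closure {x. bump a b m x \<noteq> 0} \<subseteq> cbox a b"
    unfolding bump_nonzero_iff by (simp add: closure_minimal box_subset_cbox closed_cbox)
  moreover have "compact (closure {x. bump a b m x \<noteq> 0})"
    using sub by (meson bounded_cbox bounded_subset closed_closure compact_eq_bounded_closed)
  ultimately show ?thesis using assms by (auto simp: test_functions_def)
qed

section \<open>Test functions\<close>

lemma compact_closure_subset: "compact K \<Longrightarrow> closure A \<subseteq> K \<Longrightarrow> compact (closure A)"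
  using compact_Int_closed[of K "closure A"] by (simp add: Int_absorb1)

lemma test_functionsD:
  assumes "\<phi> \<in> test_functions \<Omega>"
  shows "C_k k \<phi>" "continuous_on A \<phi>" "\<phi> differentiable at x" "x \<notin> \<Omega> \<Longrightarrow> \<phi> x = 0"
    "compact (closure {x. \<phi> x \<noteq> 0})" "closure {x. \<phi> x \<noteq> 0} \<subseteq> \<Omega>"
proof -
  have C: "C_k k \<phi>" for k using assms by (simp add: test_functions_def)
  from C show "C_k k \<phi>" .
  show "continuous_on A \<phi>" using C[of 0] by (auto intro: continuous_on_subset)
  show "\<phi> differentiable at x" using C[of "Suc 0"] by (simp add: differentiable_on_def)
  show "compact (closure {x. \<phi> x \<noteq> 0})" and sub: "closure {x. \<phi> x \<noteq> 0} \<subseteq> \<Omega>"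
    using assms by (auto simp: test_functions_def)
  show "x \<notin> \<Omega> \<Longrightarrow> \<phi> x = 0" using sub closure_subset[of "{x. \<phi> x \<noteq> 0}"] by auto
qed

text \<open>Meant for derivatives and products, whose supports lie in the support of a given test
  function: closed subsets of compact sets are compact.\<close>

lemma test_functionsI:
  assumes "\<And>k. C_k k \<psi>" "\<phi> \<in> test_functions \<Omega>" "\<And>x. x \<notin> closure {x. \<phi> x \<noteq> 0} \<Longrightarrow> \<psi> x = 0"
  shows "\<psi> \<in> test_functions \<Omega>"
proof -
  have "closure {x. \<psi> x \<noteq> 0} \<subseteq> closure {x. \<phi> x \<noteq> 0}"
    using assms(3) by (intro closure_minimal) auto
  moreover from this have "compact (closure {x. \<psi> x \<noteq> 0})"
    by (rule compact_closure_subset[OF test_functionsD(5)[OF assms(2)]])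
  ultimately show ?thesis using assms(1) test_functionsD(6)[OF assms(2)]
    by (auto simp: test_functions_def)
qed

text \<open>Off its support, \<phi> agrees with 0 on an open set, so its derivative vanishes there
  as well.\<close>

lemma test_functions_pd:
  assumes "\<phi> \<in> test_functions \<Omega>"
  shows "pd i \<phi> \<in> test_functions \<Omega>"
proof (rule test_functionsI[OF _ assms])
  show "C_k k (pd i \<phi>)" for k using test_functionsD(1)[OF assms, of "Suc k"] by simp
next
  fix x assume x: "x \<notin> closure {x. \<phi> x \<noteq> 0}"
  have "(\<phi> has_derivative (\<lambda>h. 0)) (at x)"
    by (rule has_derivative_transform_within_open[of "\<lambda>x. 0" _ _ _ "- closure {x. \<phi> x \<noteq> 0}"])
      (use x closure_subset[of "{x. \<phi> x \<noteq> 0}"] in auto)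
  then show "pd i \<phi> x = 0" by (rule pd_eq)
qed

lemma test_functions_mult:
  assumes "\<phi> \<in> test_functions \<Omega>" "\<psi> \<in> test_functions \<Omega>"
  shows "(\<lambda>x. \<phi> x * \<psi> x) \<in> test_functions \<Omega>"
proof (rule test_functionsI[OF _ assms(1)])
  show "C_k k (\<lambda>x. \<phi> x * \<psi> x)" for k
    using assms by (intro C_k_mult test_functionsD(1))
  show "\<phi> x * \<psi> x = 0" if "x \<notin> closure {x. \<phi> x \<noteq> 0}" for x
    using that closure_subset[of "{x. \<phi> x \<noteq> 0}"] by auto
qed

lemma test_functions_diff:
  assumes "\<phi> \<in> test_functions \<Omega>" "\<psi> \<in> test_functions \<Omega>"
  shows "(\<lambda>x. \<phi> x - \<psi> x) \<in> test_functions \<Omega>"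
proof -
  have "C_k k (\<lambda>x. \<phi> x + (-1) * \<psi> x)" for k
    by (intro C_k_add C_k_mult C_k_const test_functionsD(1)[OF assms(1)] test_functionsD(1)[OF assms(2)])
  then have C: "C_k k (\<lambda>x. \<phi> x - \<psi> x)" for k by simp
  have sub: "closure {x. \<phi> x - \<psi> x \<noteq> 0} \<subseteq> closure {x. \<phi> x \<noteq> 0} \<union> closure {x. \<psi> x \<noteq> 0}"
    unfolding closure_Un[symmetric] by (rule closure_mono) auto
  have "compact (closure {x. \<phi> x \<noteq> 0} \<union> closure {x. \<psi> x \<noteq> 0})"
    using assms by (intro compact_Un test_functionsD)
  then have "compact (closure {x. \<phi> x - \<psi> x \<noteq> 0})"
    using sub by (rule compact_closure_subset)
  then show ?thesis using C sub test_functionsD(6)[OF assms(1)] test_functionsD(6)[OF assms(2)]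
    by (auto simp: test_functions_def)
qed

lemma test_functions_bounded:
  assumes "\<phi> \<in> test_functions \<Omega>"
  obtains B where "B > 0" "\<And>x. \<bar>\<phi> x\<bar> \<le> B"
proof -
  have "bounded (\<phi> ` closure {x. \<phi> x \<noteq> 0})"
    using assms by (intro compact_imp_bounded compact_continuous_image test_functionsD)
  then obtain B where B: "B > 0" "\<And>x. x \<in> closure {x. \<phi> x \<noteq> 0} \<Longrightarrow> \<bar>\<phi> x\<bar> \<le> B"
    unfolding bounded_pos by auto
  show thesis
  proof
    show "\<bar>\<phi> x\<bar> \<le> B" for x
      using B closure_subset[of "{x. \<phi> x \<noteq> 0}"] by (cases "\<phi> x = 0") auto
  qed (fact B)
qed

lemma test_functions_measurable: "\<phi> \<in> test_functions \<Omega> \<Longrightarrow> \<phi> \<in> borel_measurable borel"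
  by (intro borel_measurable_continuous_onI test_functionsD)

section \<open>Integrals of derivatives of test functions\<close>

text \<open>Moves integrals over the domain to \<open>lborel\<close> on the whole space, where
  translation invariance can be used.\<close>

lemma integral_lebesgue_on_zero_outside:
  fixes h :: "real^'n::finite \<Rightarrow> real"
  assumes "open \<Omega>" "h \<in> borel_measurable borel" "\<And>x. x \<notin> \<Omega> \<Longrightarrow> h x = 0"
  shows "(LINT x|lebesgue_on \<Omega>. h x) = (LINT x|lborel. h x)"
proof -
  have "(LINT x|lebesgue_on \<Omega>. h x) = (LINT x|lebesgue. indicator \<Omega> x *\<^sub>R h x)"
    using assms(1) by (intro integral_restrict_space) (auto intro: borel_open)
  also have "(\<lambda>x. indicator \<Omega> x *\<^sub>R h x) = h" using assms(3) by (fastforce simp: indicator_def)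
  also have "(LINT x|lebesgue. h x) = (LINT x|lborel. h x)"
    using assms(2) by (intro integral_completion) simp
  finally show ?thesis .
qed

text \<open>The difference quotients \<open>q n\<close> have integral 0 by translation invariance
  and converge pointwise to the derivative. They are dominated by a constant on a fixed ball, so the
  integrals converge too.\<close>

lemma integral_pd_test_function:
  assumes "open \<Omega>" and h: "h \<in> test_functions (\<Omega> :: (real^'n::finite) set)"
  shows "(LINT x|lebesgue_on \<Omega>. pd i h x) = 0"
proof -
  note [measurable] = test_functions_measurable[OF h] test_functions_measurable[OF test_functions_pd[OF h]]
  define e :: "real^'n" where "e = axis i 1"
  define q where "q n x = (h (x + inverse (real (Suc n)) *\<^sub>R e) - h x) / inverse (real (Suc n))" for n x
  obtain B where B: "B > 0" "\<And>x. \<bar>pd i h x\<bar> \<le> B"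
    using test_functions_bounded[OF test_functions_pd[OF h]] by metis
  obtain R where R: "R > 0" "\<And>x. x \<in> closure {x. h x \<noteq> 0} \<Longrightarrow> norm x \<le> R"
    using compact_imp_bounded[OF test_functionsD(5)[OF h]] unfolding bounded_pos by auto
  have supp: "norm x \<le> R" if "h x \<noteq> 0" for x
    using R(2) closure_subset[of "{x. h x \<noteq> 0}"] that by auto
  have der: "((\<lambda>s. h (x + s *\<^sub>R e)) has_real_derivative pd i h (x + s *\<^sub>R e)) (at s)" for x s
  proof -
    have "((\<lambda>s. h (x + s *\<^sub>R e)) has_derivative
        (\<lambda>s'. frechet_derivative h (at (x + s *\<^sub>R e)) (s' *\<^sub>R e))) (at s)"
      using test_functionsD(3)[OF h, of "x + s *\<^sub>R e"] unfolding frechet_derivative_works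
      by (rule has_derivative_compose[rotated]) (auto intro!: derivative_eq_intros)
    moreover have "frechet_derivative h (at (x + s *\<^sub>R e)) (s' *\<^sub>R e) = pd i h (x + s *\<^sub>R e) * s'" for s'
      using linear_frechet_derivative[OF test_functionsD(3)[OF h, of "x + s *\<^sub>R e"]]
      by (simp add: linear_cmul pd_def e_def)
    ultimately show ?thesis by (simp add: has_field_derivative_def)
  qed
  \<comment> \<open>By the mean value theorem a difference quotient is a value of the derivative,
    hence bounded by \<open>B\<close> uniformly in \<open>n\<close>.\<close>
  have qB: "\<bar>q n x\<bar> \<le> B" for n x
  proof -
    let ?t = "inverse (real (Suc n))"
    have t: "0 < ?t" by simp
    obtain z where "h (x + ?t *\<^sub>R e) - h (x + 0 *\<^sub>R e) = (?t - 0) * pd i h (x + z *\<^sub>R e)"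
      using MVT2[OF t der] by metis
    then have "q n x = pd i h (x + z *\<^sub>R e)" using t by (simp add: q_def field_simps del: of_nat_Suc)
    then show ?thesis using B by simp
  qed
  \<comment> \<open>The steps have length at most 1, so enlarging the radius of the support by 1
    accommodates all shifted copies.\<close>
  have q0: "q n x = 0" if "x \<notin> cball 0 (R + 1)" for n x
  proof -
    have "norm (inverse (real (Suc n)) *\<^sub>R e) \<le> 1" by (simp add: e_def field_simps)
    then have "norm x \<le> norm (x + inverse (real (Suc n)) *\<^sub>R e) + 1"
      by (smt (verit) norm_triangle_ineq4 add_diff_cancel_right')
    then have "h x = 0" "h (x + inverse (real (Suc n)) *\<^sub>R e) = 0"
      using supp[of x] supp[of "x + inverse (real (Suc n)) *\<^sub>R e"] that by force+
    then show ?thesis by (simp add: q_def)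
  qed
  have lim: "(\<lambda>n. q n x) \<longlonglongrightarrow> pd i h x" for x
  proof -
    have "((\<lambda>t. (h (x + t *\<^sub>R e) - h x) / t) \<longlongrightarrow> pd i h x) (at 0)"
      using der[of x 0] by (simp add: DERIV_def)
    moreover have "filterlim (\<lambda>n. inverse (real (Suc n))) (at 0) sequentially"
      by (intro filterlim_atI LIMSEQ_inverse_real_of_nat) auto
    ultimately show ?thesis unfolding q_def by (rule filterlim_compose)
  qed
  obtain C where C: "C > 0" "\<And>x. \<bar>h x\<bar> \<le> C" using test_functions_bounded[OF h] by metis
  have hint: "integrable lborel h"
  proof (rule Bochner_Integration.integrable_bound)
    show "AE x in lborel. norm (h x) \<le> norm (C * indicator (cball 0 R) x :: real)"
      using C supp by (intro AE_I2) (force simp: indicator_def)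
    show "integrable lborel (\<lambda>x. C * indicator (cball 0 R) x :: real)"
      by (intro integrable_mult_right integrable_real_indicator emeasure_lborel_cball_finite) auto
  qed simp
  have shift: "integrable lborel (\<lambda>x. h (x + c))" "(LINT x|lborel. h (x + c)) = (LINT x|lborel. h x)" for c
  proof -
    have "integrable (distr lborel borel ((+) c)) h" using hint by (simp only: lborel_distr_plus)
    then show "integrable lborel (\<lambda>x. h (x + c))" by (subst (asm) integrable_distr_eq) (auto simp: add.commute)
    have "(LINT x|distr lborel borel ((+) c). h x) = (LINT x|lborel. h (c + x))"
      by (rule integral_distr) auto
    then show "(LINT x|lborel. h (x + c)) = (LINT x|lborel. h x)"
      by (simp add: lborel_distr_plus add.commute)
  qed
  have "(\<lambda>n. LINT x|lborel. q n x) \<longlonglongrightarrow> (LINT x|lborel. pd i h x)"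
  proof (rule integral_dominated_convergence[where w = "\<lambda>x. B * indicator (cball 0 (R + 1)) x"])
    show "integrable lborel (\<lambda>x :: real^'n. B * indicator (cball 0 (R + 1)) x :: real)"
      by (intro integrable_mult_right integrable_real_indicator emeasure_lborel_cball_finite) auto
    show "AE x in lborel. norm (q n x) \<le> B * indicator (cball 0 (R + 1)) x" for n
      using qB q0 by (intro AE_I2) (auto simp: indicator_def)
    show "q n \<in> borel_measurable lborel" for n unfolding q_def by measurable
  qed (use lim in auto)
  moreover have "(LINT x|lborel. q n x) = 0" for n
    unfolding q_def using hint shift by simp
  ultimately have "(LINT x|lborel. pd i h x) = 0" by (simp add: LIMSEQ_const_iff)
  then show ?thesis
    using assms test_functions_pd[OF h]
    by (subst integral_lebesgue_on_zero_outside) (auto intro: test_functionsD(4) test_functions_measurable)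
qed

section \<open>The fundamental lemma of the calculus of variations\<close>

text \<open>The bump functions are test functions between 0 and 1 that converge to the indicator of
  the open box, so dominated convergence with majorant |f| applies. The function is extended by zero
  because Lebesgue differentiation is applied on the whole space.\<close>

lemma integral_box_eq_0:
  fixes f :: "real^'n::finite \<Rightarrow> real"
  assumes \<Omega>: "open \<Omega>" and f: "integrable (lebesgue_on \<Omega>) f"
    and orth: "\<And>\<phi>. \<phi> \<in> test_functions \<Omega> \<Longrightarrow> (LINT x|lebesgue_on \<Omega>. f x * \<phi> x) = 0"
    and sub: "cbox a b \<subseteq> \<Omega>"
  shows "integral (cbox a b) (\<lambda>x. indicator \<Omega> x *\<^sub>R f x) = 0"
proof -
  have S: "\<Omega> \<in> sets lebesgue" using borel_open[OF \<Omega>] by simp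
  have g: "integrable lebesgue (\<lambda>x. indicator \<Omega> x *\<^sub>R f x)"
    using f S integrable_restrict_space[of \<Omega> lebesgue f] by simp
  have bump_meas: "bump a b m \<in> borel_measurable (lebesgue_on \<Omega>)" for m
    by (intro continuous_imp_measurable_on_sets_lebesgue S test_functionsD(2)[OF bump_test_function[OF sub]])
  have box_meas: "(indicator (box a b) :: _ \<Rightarrow> real) \<in> borel_measurable (lebesgue_on \<Omega>)"
    by (intro measurable_restrict_space1 borel_measurable_indicator sets_completionI_sets) simp
  have "(\<lambda>m. LINT x|lebesgue_on \<Omega>. f x * bump a b m x) \<longlonglongrightarrow> (LINT x|lebesgue_on \<Omega>. f x * indicator (box a b) x)"
  proof (rule integral_dominated_convergence[where w = "\<lambda>x. \<bar>f x\<bar>"])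
    show "AE x in lebesgue_on \<Omega>. norm (f x * bump a b m x) \<le> \<bar>f x\<bar>" for m
      by (intro AE_I2) (simp add: abs_mult mult_left_le bump_bounds abs_of_nonneg[OF bump_bounds(1)])
    show "AE x in lebesgue_on \<Omega>. (\<lambda>m. f x * bump a b m x) \<longlonglongrightarrow> f x * indicator (box a b) x"
      by (intro AE_I2 tendsto_mult_left bump_tendsto_indicator)
    show "integrable (lebesgue_on \<Omega>) (\<lambda>x. \<bar>f x\<bar>)"
      using f by simp
    show "(\<lambda>x. f x * bump a b m x) \<in> borel_measurable (lebesgue_on \<Omega>)" for m
      using f bump_meas by (intro borel_measurable_times) simp_all
    show "(\<lambda>x. f x * indicator (box a b) x) \<in> borel_measurable (lebesgue_on \<Omega>)"
      using f box_meas by (intro borel_measurable_times) simp_all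
  qed
  then have "(LINT x|lebesgue_on \<Omega>. f x * indicator (box a b) x) = 0"
    using orth[OF bump_test_function[OF sub]] by (simp add: LIMSEQ_const_iff)
  also have "(LINT x|lebesgue_on \<Omega>. f x * indicator (box a b) x) =
      (LINT x|lebesgue. indicator \<Omega> x *\<^sub>R (f x * indicator (box a b) x))"
    using S by (intro integral_restrict_space) auto
  also have "\<dots> = (LINT x:box a b|lebesgue. indicator \<Omega> x *\<^sub>R f x)"
    unfolding set_lebesgue_integral_def by (simp add: ac_simps)
  \<comment> \<open>The Lebesgue integral becomes the gauge integral, the one for which the
    differentiation theorem is stated. The boundary of the box contributes nothing, so open and
    closed boxes have the same integral.\<close>
  also have "\<dots> = integral (box a b) (\<lambda>x. indicator \<Omega> x *\<^sub>R f x)"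
    by (rule set_lebesgue_integral_eq_integral, rule set_integrable_subset[OF _ _ subset_UNIV])
      (use g in \<open>auto simp: set_integrable_def\<close>)
  finally show ?thesis by (simp add: integral_open_interval)
qed

lemma AE_eq_0_if_orthogonal_test_functions:
  fixes f :: "real^'n::finite \<Rightarrow> real"
  assumes \<Omega>: "open \<Omega>" and f: "integrable (lebesgue_on \<Omega>) f"
    and orth: "\<And>\<phi>. \<phi> \<in> test_functions \<Omega> \<Longrightarrow> (LINT x|lebesgue_on \<Omega>. f x * \<phi> x) = 0"
  shows "AE x in lebesgue_on \<Omega>. f x = 0"
proof -
  have S: "\<Omega> \<in> sets lebesgue" using borel_open[OF \<Omega>] by simp
  define g where "g = (\<lambda>x. indicator \<Omega> x *\<^sub>R f x)"
  have "integrable lebesgue g"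
    unfolding g_def using f S integrable_restrict_space[of \<Omega> lebesgue f] by simp
  then have "set_integrable lebesgue UNIV g" by (simp add: set_integrable_def)
  then have "g integrable_on cbox a b" for a b
    by (intro set_lebesgue_integral_eq_integral(1)) (erule set_integrable_subset, auto)
  \<comment> \<open>Lebesgue differentiation: outside a negligible set, the averages of
    \<open>g\<close> over the cubes with lower corner \<open>x\<close> and side \<open>h\<close>
    tend to \<open>g x\<close>.\<close>
  then obtain N where N: "negligible N" "\<And>x e. \<lbrakk>x \<notin> N; 0 < e\<rbrakk> \<Longrightarrow> \<exists>d>0. \<forall>h. 0 < h \<and> h < d \<longrightarrow>
      norm (integral (cbox x (x + h *\<^sub>R One)) g /\<^sub>R h ^ DIM(real^'n) - g x) < e"
    by (rule integrable_ccontinuous_explicit) (rule that)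
  have "f x = 0" if x: "x \<in> \<Omega>" "x \<notin> N" for x
  proof -
    have "\<bar>f x\<bar> \<le> 0 + e" if e: "e > 0" for e
    proof -
      obtain d where d: "d > 0" "\<And>h. 0 < h \<Longrightarrow> h < d \<Longrightarrow>
          norm (integral (cbox x (x + h *\<^sub>R One)) g /\<^sub>R h ^ DIM(real^'n) - g x) < e"
        using N(2)[OF x(2) e] by blast
      obtain r where r: "r > 0" "cball x r \<subseteq> \<Omega>" using \<Omega> x by (meson open_contains_cball)
      \<comment> \<open>Half of \<open>d\<close> keeps \<open>h\<close> strictly below
        \<open>d\<close>. The second bound makes the diagonal of the cube at most \<open>r\<close>,
        so that the cube stays inside the domain and its average is 0.\<close>
      define h where "h = min (d / 2) (r / norm (One :: real^'n))"
      have "norm (One :: real^'n) > 0" by simp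
      then have h: "0 < h" "h < d" "h * norm (One :: real^'n) \<le> r"
        using d r by (auto simp: h_def min_def field_simps)
      have "cbox x (x + h *\<^sub>R One) \<subseteq> cball x r"
      proof
        fix y assume y: "y \<in> cbox x (x + h *\<^sub>R One)"
        have "norm (y - x) \<le> norm (h *\<^sub>R One :: real^'n)"
          using y h(1) by (intro norm_le_componentwise) (force simp: mem_box inner_diff_left inner_add_left)
        then show "y \<in> cball x r" using h by (simp add: dist_norm norm_minus_commute)
      qed
      then have "integral (cbox x (x + h *\<^sub>R One)) g = 0"
        unfolding g_def using r by (intro integral_box_eq_0 assms) auto
      then show ?thesis using d(2)[OF h(1,2)] x by (simp add: g_def)
    qed
    then show "f x = 0" using field_le_epsilon[of "\<bar>f x\<bar>" 0] by simp
  qed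
  then have "AE x in lebesgue. x \<in> \<Omega> \<longrightarrow> f x = 0"
    using N(1) by (intro AE_I'[of N]) (auto simp: negligible_iff_null_sets)
  then show ?thesis using S by (subst AE_restrict_space_iff) auto
qed

section \<open>Square-integrable classes\<close>

text \<open>The functions whose classes form \<open>L2 \<Omega>\<close>, so that identities between
  classes can be reduced to identities between functions.\<close>

definition sq_integrable :: "(real^'n::finite) set \<Rightarrow> (real^'n \<Rightarrow> real) set" where
  "sq_integrable \<Omega> = {u \<in> borel_measurable (lebesgue_on \<Omega>). integrable (lebesgue_on \<Omega>) (\<lambda>x. (u x)\<^sup>2)}"

lemma sq_integrable_measurable: "u \<in> sq_integrable \<Omega> \<Longrightarrow> u \<in> borel_measurable (lebesgue_on \<Omega>)"
  by (simp add: sq_integrable_def)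

text \<open>The majorant comes from 2|ab| \<le> a^2 + b^2.\<close>

lemma sq_integrable_mult:
  assumes "u \<in> sq_integrable \<Omega>" "v \<in> sq_integrable \<Omega>"
  shows "integrable (lebesgue_on \<Omega>) (\<lambda>x. u x * v x)"
proof (rule Bochner_Integration.integrable_bound)
  show "integrable (lebesgue_on \<Omega>) (\<lambda>x. (u x)\<^sup>2 + (v x)\<^sup>2)"
    using assms by (simp add: sq_integrable_def)
  show "(\<lambda>x. u x * v x) \<in> borel_measurable (lebesgue_on \<Omega>)"
    using assms by (intro borel_measurable_times sq_integrable_measurable)
  have "\<bar>a * b\<bar> \<le> a\<^sup>2 + b\<^sup>2" for a b :: real
  proof -
    have "2 * \<bar>a * b\<bar> \<le> a\<^sup>2 + b\<^sup>2"
      using sum_squares_bound[of "\<bar>a\<bar>" "\<bar>b\<bar>"] by (simp add: abs_mult)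
    then show ?thesis by linarith
  qed
  then show "AE x in lebesgue_on \<Omega>. norm (u x * v x) \<le> norm ((u x)\<^sup>2 + (v x)\<^sup>2)"
    by (intro AE_I2) simp
qed

lemma sq_integrable_diff:
  assumes "u \<in> sq_integrable \<Omega>" "v \<in> sq_integrable \<Omega>"
  shows "(\<lambda>x. u x - v x) \<in> sq_integrable \<Omega>"
proof -
  have "integrable (lebesgue_on \<Omega>) (\<lambda>x. u x * u x - 2 * (u x * v x) + v x * v x)"
    by (intro Bochner_Integration.integrable_add Bochner_Integration.integrable_diff integrable_mult_right
        sq_integrable_mult assms)
  also have "(\<lambda>x. u x * u x - 2 * (u x * v x) + v x * v x) = (\<lambda>x. (u x - v x)\<^sup>2)"
    by (auto simp: power2_eq_square algebra_simps)
  finally show ?thesis using assms by (auto simp: sq_integrable_def)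
qed

text \<open>A measurable function belongs to its own class, so the choice in \<open>rep\<close>
  ranges over a non-empty set and returns a member of that class.\<close>

lemma
  assumes "u \<in> borel_measurable (lebesgue_on \<Omega>)"
  shows rep_cls_measurable: "rep (cls \<Omega> u) \<in> borel_measurable (lebesgue_on \<Omega>)"
    and AE_rep_cls: "AE x in lebesgue_on \<Omega>. rep (cls \<Omega> u) x = u x"
proof -
  have "u \<in> cls \<Omega> u" using assms by (auto simp: cls_def ae_rel_def)
  then have "rep (cls \<Omega> u) \<in> cls \<Omega> u" unfolding rep_def by (rule someI[where P = "\<lambda>v. v \<in> cls \<Omega> u"])
  then have "(u, rep (cls \<Omega> u)) \<in> ae_rel \<Omega>" by (simp add: cls_def)
  then show "rep (cls \<Omega> u) \<in> borel_measurable (lebesgue_on \<Omega>)" "AE x in lebesgue_on \<Omega>. rep (cls \<Omega> u) x = u x"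
    by (auto simp: ae_rel_def eq_commute)
qed

lemma cls_eqI:
  assumes "u \<in> borel_measurable (lebesgue_on \<Omega>)" "v \<in> borel_measurable (lebesgue_on \<Omega>)"
    "AE x in lebesgue_on \<Omega>. u x = v x"
  shows "cls \<Omega> u = cls \<Omega> v"
proof -
  have "(AE x in lebesgue_on \<Omega>. u x = w x) \<longleftrightarrow> (AE x in lebesgue_on \<Omega>. v x = w x)" for w
  proof
    assume "AE x in lebesgue_on \<Omega>. u x = w x"
    then show "AE x in lebesgue_on \<Omega>. v x = w x" using assms(3) by eventually_elim simp
  next
    assume "AE x in lebesgue_on \<Omega>. v x = w x"
    then show "AE x in lebesgue_on \<Omega>. u x = w x" using assms(3) by eventually_elim simp
  qed
  then show ?thesis using assms(1,2) by (auto simp: cls_def ae_rel_def)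
qed

text \<open>Replaces the chosen representatives by arbitrary ones, which turns identities between
  iterated differences of classes into pointwise algebra.\<close>

lemma cdiff_cls:
  assumes "u \<in> borel_measurable (lebesgue_on \<Omega>)" "v \<in> borel_measurable (lebesgue_on \<Omega>)"
  shows "cdiff \<Omega> (cls \<Omega> u) (cls \<Omega> v) = cls \<Omega> (\<lambda>x. u x - v x)"
  unfolding cdiff_def
proof (rule cls_eqI)
  show "AE x in lebesgue_on \<Omega>. rep (cls \<Omega> u) x - rep (cls \<Omega> v) x = u x - v x"
    using AE_rep_cls[OF assms(1)] AE_rep_cls[OF assms(2)] by eventually_elim simp
qed (use assms in \<open>auto intro: borel_measurable_diff rep_cls_measurable\<close>)

lemma cls_in_L2: "u \<in> sq_integrable \<Omega> \<Longrightarrow> cls \<Omega> u \<in> L2 \<Omega>"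
  unfolding L2_def cls_def sq_integrable_def by (rule quotientI)

lemma L2_cases:
  assumes "U \<in> L2 \<Omega>"
  obtains u where "u \<in> sq_integrable \<Omega>" "U = cls \<Omega> u"
  using assms unfolding L2_def cls_def sq_integrable_def by (rule quotientE)

lemma rep_in_sq_integrable:
  assumes "U \<in> L2 \<Omega>"
  shows "rep U \<in> sq_integrable \<Omega>"
proof -
  obtain u where u: "u \<in> sq_integrable \<Omega>" "U = cls \<Omega> u" using assms by (rule L2_cases)
  note m = sq_integrable_measurable[OF u(1)]
  have "integrable (lebesgue_on \<Omega>) (\<lambda>x. (rep U x)\<^sup>2) \<longleftrightarrow> integrable (lebesgue_on \<Omega>) (\<lambda>x. (u x)\<^sup>2)"
  proof (rule integrable_cong_AE)
    show "AE x in lebesgue_on \<Omega>. (rep U x)\<^sup>2 = (u x)\<^sup>2"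
      using AE_rep_cls[OF m] unfolding u(2) by eventually_elim simp
  qed (use m rep_cls_measurable[OF m] u(2) in auto)
  then show ?thesis using u rep_cls_measurable[OF m] by (simp add: sq_integrable_def)
qed

lemma cls_rep:
  assumes "U \<in> L2 \<Omega>"
  shows "cls \<Omega> (rep U) = U"
proof -
  obtain u where u: "u \<in> sq_integrable \<Omega>" "U = cls \<Omega> u" using assms by (rule L2_cases)
  note m = sq_integrable_measurable[OF u(1)]
  show ?thesis unfolding u(2) by (rule cls_eqI[OF rep_cls_measurable[OF m] m AE_rep_cls[OF m]])
qed

lemma cdiff_in_L2: "U \<in> L2 \<Omega> \<Longrightarrow> V \<in> L2 \<Omega> \<Longrightarrow> cdiff \<Omega> U V \<in> L2 \<Omega>"
  unfolding cdiff_def by (intro cls_in_L2 sq_integrable_diff rep_in_sq_integrable)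

lemma AE_rep_cdiff:
  assumes "U \<in> L2 \<Omega>" "V \<in> L2 \<Omega>"
  shows "AE x in lebesgue_on \<Omega>. rep (cdiff \<Omega> U V) x = rep U x - rep V x"
  unfolding cdiff_def
  by (intro AE_rep_cls sq_integrable_measurable sq_integrable_diff rep_in_sq_integrable assms)

text \<open>Used to compare a difference of two classes with a difference of their approximants: the
  error is the difference of the two errors.\<close>

lemma cdiff_cdiff_cdiff:
  assumes "A \<in> L2 \<Omega>" "B \<in> L2 \<Omega>" "C \<in> L2 \<Omega>" "D \<in> L2 \<Omega>"
  shows "cdiff \<Omega> (cdiff \<Omega> A B) (cdiff \<Omega> C D) = cdiff \<Omega> (cdiff \<Omega> A C) (cdiff \<Omega> B D)"
proof -
  obtain a b c d where "a \<in> sq_integrable \<Omega>" "b \<in> sq_integrable \<Omega>" "c \<in> sq_integrable \<Omega>" "d \<in> sq_integrable \<Omega>"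
    "A = cls \<Omega> a" "B = cls \<Omega> b" "C = cls \<Omega> c" "D = cls \<Omega> d"
    using assms by (meson L2_cases)
  then show ?thesis by (simp add: cdiff_cls sq_integrable_measurable sq_integrable_diff algebra_simps)
qed

text \<open>Pointwise, (a - b)^2 \<le> 2a^2 + 2b^2, which is (a + b)^2 \<ge> 0 rearranged.\<close>

lemma inner_L2_cdiff_le:
  assumes "U \<in> L2 \<Omega>" "V \<in> L2 \<Omega>"
  shows "inner_L2 \<Omega> (cdiff \<Omega> U V) (cdiff \<Omega> U V) \<le> 2 * inner_L2 \<Omega> U U + 2 * inner_L2 \<Omega> V V"
proof -
  note int = sq_integrable_mult[OF rep_in_sq_integrable rep_in_sq_integrable]
  have "inner_L2 \<Omega> (cdiff \<Omega> U V) (cdiff \<Omega> U V) \<le>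
      (LINT x|lebesgue_on \<Omega>. 2 * (rep U x * rep U x) + 2 * (rep V x * rep V x))"
    unfolding inner_L2_def
  proof (rule integral_mono_AE)
    show "AE x in lebesgue_on \<Omega>. rep (cdiff \<Omega> U V) x * rep (cdiff \<Omega> U V) x \<le>
        2 * (rep U x * rep U x) + 2 * (rep V x * rep V x)"
      using AE_rep_cdiff[OF assms]
    proof eventually_elim
      case (elim x)
      show ?case using zero_le_power2[of "rep U x + rep V x"] unfolding elim
        by (simp add: power2_eq_square algebra_simps)
    qed
  qed (use assms in \<open>auto intro!: int cdiff_in_L2\<close>)
  also have "\<dots> = 2 * inner_L2 \<Omega> U U + 2 * inner_L2 \<Omega> V V"
    unfolding inner_L2_def using int[OF assms(1,1)] int[OF assms(2,2)] by simp
  finally show ?thesis .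
qed

section \<open>Weak derivatives and Sobolev spaces\<close>

context
  fixes \<Omega> :: "(real^'n::finite) set"
  assumes open_domain: "open \<Omega>" and bounded_domain: "bounded \<Omega>"
begin

text \<open>A bounded open set has finite measure, so the constant \<open>B\<^sup>2\<close> is an
  integrable majorant.\<close>

lemma bounded_measurable_sq_integrable:
  fixes u :: "real^'n \<Rightarrow> real"
  assumes "u \<in> borel_measurable (lebesgue_on \<Omega>)" "\<And>x. \<bar>u x\<bar> \<le> B"
  shows "u \<in> sq_integrable \<Omega>"
proof -
  have "\<Omega> \<in> lmeasurable" using open_domain bounded_domain by (simp add: lmeasurable_open)
  then interpret finite_measure "lebesgue_on \<Omega>" by (rule finite_measure_lebesgue_on)
  have "integrable (lebesgue_on \<Omega>) (\<lambda>x. (u x)\<^sup>2)"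
  proof (rule integrable_const_bound)
    show "AE x in lebesgue_on \<Omega>. norm ((u x)\<^sup>2) \<le> B\<^sup>2"
      using assms(2) by (intro AE_I2) (metis abs_ge_zero norm_power power_mono real_norm_def)
  qed (use assms(1) in auto)
  then show ?thesis using assms(1) by (simp add: sq_integrable_def)
qed

lemma test_function_sq_integrable:
  assumes "\<phi> \<in> test_functions \<Omega>"
  shows "\<phi> \<in> sq_integrable \<Omega>"
proof -
  obtain B where "\<And>x. \<bar>\<phi> x\<bar> \<le> B" using test_functions_bounded[OF assms] by metis
  moreover have "\<phi> \<in> borel_measurable (lebesgue_on \<Omega>)"
    using borel_open[OF open_domain]
    by (intro continuous_imp_measurable_on_sets_lebesgue test_functionsD(2)[OF assms]) simp
  ultimately show ?thesis by (rule bounded_measurable_sq_integrable[rotated])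
qed

text \<open>The constant 1 is square-integrable on a set of finite measure, and products of
  square-integrable functions are integrable.\<close>

lemma sq_integrable_imp_integrable:
  assumes "u \<in> sq_integrable \<Omega>"
  shows "integrable (lebesgue_on \<Omega>) u"
proof -
  have "(\<lambda>x. 1) \<in> sq_integrable \<Omega>" by (rule bounded_measurable_sq_integrable[of _ 1]) auto
  then show ?thesis using sq_integrable_mult[OF assms] by force
qed

text \<open>Integrals do not see null sets, so the defining identity may be tested on any
  representatives instead of those chosen by \<open>rep\<close>.\<close>

lemma is_weak_pd_iff:
  assumes u: "u \<in> borel_measurable (lebesgue_on \<Omega>)" "AE x in lebesgue_on \<Omega>. rep U x = u x"
    and v: "v \<in> borel_measurable (lebesgue_on \<Omega>)" "AE x in lebesgue_on \<Omega>. rep V x = v x"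
    and U: "U \<in> L2 \<Omega>" and V: "V \<in> L2 \<Omega>"
  shows "is_weak_pd \<Omega> i U V \<longleftrightarrow> (\<forall>\<phi>\<in>test_functions \<Omega>.
    (LINT x|lebesgue_on \<Omega>. u x * pd i \<phi> x) = - (LINT x|lebesgue_on \<Omega>. v x * \<phi> x))"
  unfolding is_weak_pd_def
proof (rule ball_cong[OF refl])
  fix \<phi> assume \<phi>: "\<phi> \<in> test_functions \<Omega>"
  have cong: "(LINT x|lebesgue_on \<Omega>. rep W x * \<psi> x) = (LINT x|lebesgue_on \<Omega>. w x * \<psi> x)"
    if w: "w \<in> borel_measurable (lebesgue_on \<Omega>)" "AE x in lebesgue_on \<Omega>. rep W x = w x"
      and W: "W \<in> L2 \<Omega>" and \<psi>: "\<psi> \<in> test_functions \<Omega>" for w W \<psi>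
  proof (rule integral_cong_AE)
    show "AE x in lebesgue_on \<Omega>. rep W x * \<psi> x = w x * \<psi> x" using w(2) by eventually_elim simp
  qed (intro borel_measurable_times w sq_integrable_measurable rep_in_sq_integrable
      test_function_sq_integrable W \<psi>)+
  show "(LINT x|lebesgue_on \<Omega>. rep U x * pd i \<phi> x) = - (LINT x|lebesgue_on \<Omega>. rep V x * \<phi> x) \<longleftrightarrow>
      (LINT x|lebesgue_on \<Omega>. u x * pd i \<phi> x) = - (LINT x|lebesgue_on \<Omega>. v x * \<phi> x)"
    using cong[OF u U test_functions_pd[OF \<phi>]] cong[OF v V \<phi>] by simp
qed

text \<open>Subtracting the two defining identities shows that the difference of the candidates is
  orthogonal to all test functions; the fundamental lemma makes it vanish almost everywhere.\<close>

lemma is_weak_pd_unique: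
  assumes "V \<in> L2 \<Omega>" "is_weak_pd \<Omega> i U V" "W \<in> L2 \<Omega>" "is_weak_pd \<Omega> i U W"
  shows "V = W"
proof -
  note [simp] = rep_in_sq_integrable assms(1,3)
  have "AE x in lebesgue_on \<Omega>. rep V x - rep W x = 0"
  proof (rule AE_eq_0_if_orthogonal_test_functions[OF open_domain])
    show "integrable (lebesgue_on \<Omega>) (\<lambda>x. rep V x - rep W x)"
      by (intro sq_integrable_imp_integrable sq_integrable_diff) simp_all
    show "(LINT x|lebesgue_on \<Omega>. (rep V x - rep W x) * \<phi> x) = 0" if \<phi>: "\<phi> \<in> test_functions \<Omega>" for \<phi>
    proof -
      have "(LINT x|lebesgue_on \<Omega>. (rep V x - rep W x) * \<phi> x) =
          (LINT x|lebesgue_on \<Omega>. rep V x * \<phi> x) - (LINT x|lebesgue_on \<Omega>. rep W x * \<phi> x)"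
        unfolding left_diff_distrib
        by (intro Bochner_Integration.integral_diff sq_integrable_mult rep_in_sq_integrable
            test_function_sq_integrable assms \<phi>)
      then show ?thesis using assms(2,4) \<phi> by (simp add: is_weak_pd_def)
    qed
  qed
  then have "cls \<Omega> (rep V) = cls \<Omega> (rep W)" by (intro cls_eqI) (auto intro: sq_integrable_measurable)
  then show ?thesis using assms cls_rep by metis
qed

lemma weak_pd_eqI:
  assumes "V \<in> L2 \<Omega>" "is_weak_pd \<Omega> i U V"
  shows "weak_pd \<Omega> i U = V"
  unfolding weak_pd_def
proof (rule the_equality)
  fix W assume "W \<in> L2 \<Omega> \<and> is_weak_pd \<Omega> i U W"
  then show "W = V" by (intro is_weak_pd_unique[of W i U V] assms) simp_all
qed (use assms in simp)

lemma W21_weak_pd: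
  assumes "U \<in> W21 \<Omega>"
  shows "U \<in> L2 \<Omega>" "weak_pd \<Omega> i U \<in> L2 \<Omega>" "is_weak_pd \<Omega> i U (weak_pd \<Omega> i U)"
  using assms weak_pd_eqI unfolding W21_def by fastforce+

text \<open>Both sides of the defining identity are linear, the integrals splitting because products
  of square-integrable functions are integrable.\<close>

lemma is_weak_pd_cdiff:
  assumes U: "U \<in> L2 \<Omega>" "U' \<in> L2 \<Omega>" "is_weak_pd \<Omega> i U U'"
    and V: "V \<in> L2 \<Omega>" "V' \<in> L2 \<Omega>" "is_weak_pd \<Omega> i V V'"
  shows "is_weak_pd \<Omega> i (cdiff \<Omega> U V) (cdiff \<Omega> U' V')"
proof (subst is_weak_pd_iff)
  show "\<forall>\<phi>\<in>test_functions \<Omega>. (LINT x|lebesgue_on \<Omega>. (rep U x - rep V x) * pd i \<phi> x) =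
      - (LINT x|lebesgue_on \<Omega>. (rep U' x - rep V' x) * \<phi> x)"
  proof
    fix \<phi> assume \<phi>: "\<phi> \<in> test_functions \<Omega>"
    have split: "(LINT x|lebesgue_on \<Omega>. (rep A x - rep B x) * \<psi> x) =
        (LINT x|lebesgue_on \<Omega>. rep A x * \<psi> x) - (LINT x|lebesgue_on \<Omega>. rep B x * \<psi> x)"
      if "A \<in> L2 \<Omega>" "B \<in> L2 \<Omega>" "\<psi> \<in> test_functions \<Omega>" for A B \<psi>
      unfolding left_diff_distrib
      by (intro Bochner_Integration.integral_diff sq_integrable_mult rep_in_sq_integrable
          test_function_sq_integrable that)
    show "(LINT x|lebesgue_on \<Omega>. (rep U x - rep V x) * pd i \<phi> x) =
        - (LINT x|lebesgue_on \<Omega>. (rep U' x - rep V' x) * \<phi> x)"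
      using U(3) V(3) \<phi>
      by (simp add: split[OF U(1) V(1) test_functions_pd[OF \<phi>]] split[OF U(2) V(2) \<phi>] is_weak_pd_def)
  qed
qed (intro AE_rep_cdiff cdiff_in_L2 sq_integrable_measurable sq_integrable_diff rep_in_sq_integrable U V)+

text \<open>The difference of the weak derivatives satisfies the defining identity, and uniqueness
  identifies it with the value of \<open>weak_pd\<close>.\<close>

lemma
  assumes "U \<in> W21 \<Omega>" "V \<in> W21 \<Omega>"
  shows cdiff_in_W21: "cdiff \<Omega> U V \<in> W21 \<Omega>"
    and weak_pd_cdiff: "weak_pd \<Omega> i (cdiff \<Omega> U V) = cdiff \<Omega> (weak_pd \<Omega> i U) (weak_pd \<Omega> i V)"
proof -
  have *: "cdiff \<Omega> (weak_pd \<Omega> i U) (weak_pd \<Omega> i V) \<in> L2 \<Omega>"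
    "is_weak_pd \<Omega> i (cdiff \<Omega> U V) (cdiff \<Omega> (weak_pd \<Omega> i U) (weak_pd \<Omega> i V))" for i
    by (intro cdiff_in_L2 is_weak_pd_cdiff W21_weak_pd assms)+
  then show "cdiff \<Omega> U V \<in> W21 \<Omega>"
    using cdiff_in_L2[OF W21_weak_pd(1)[OF assms(1)] W21_weak_pd(1)[OF assms(2)]]
    unfolding W21_def by blast
  show "weak_pd \<Omega> i (cdiff \<Omega> U V) = cdiff \<Omega> (weak_pd \<Omega> i U) (weak_pd \<Omega> i V)"
    using * by (rule weak_pd_eqI)
qed

section \<open>Norm estimates for differences\<close>

lemma inner_nabla_eq_sum:
  assumes "U \<in> W21 \<Omega>"
  shows "inner_nabla \<Omega> U U = (\<Sum>i\<in>UNIV. inner_L2 \<Omega> (weak_pd \<Omega> i U) (weak_pd \<Omega> i U))"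
  unfolding inner_nabla_def inner_L2_def
  by (intro Bochner_Integration.integral_sum sq_integrable_mult rep_in_sq_integrable W21_weak_pd assms)

text \<open>The estimate for \<open>inner_L2\<close> is applied to the functions and to each of
  their weak derivatives, and the results are added up.\<close>

lemma inner_12_cdiff_le:
  assumes "U \<in> W21 \<Omega>" "V \<in> W21 \<Omega>"
  shows "inner_12 \<Omega> (cdiff \<Omega> U V) (cdiff \<Omega> U V) \<le> 2 * inner_12 \<Omega> U U + 2 * inner_12 \<Omega> V V"
proof -
  have "inner_nabla \<Omega> (cdiff \<Omega> U V) (cdiff \<Omega> U V) \<le>
      (\<Sum>i\<in>UNIV. 2 * inner_L2 \<Omega> (weak_pd \<Omega> i U) (weak_pd \<Omega> i U) + 2 * inner_L2 \<Omega> (weak_pd \<Omega> i V) (weak_pd \<Omega> i V))"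
    unfolding inner_nabla_eq_sum[OF cdiff_in_W21[OF assms]] weak_pd_cdiff[OF assms]
    by (intro sum_mono inner_L2_cdiff_le W21_weak_pd assms)
  also have "\<dots> = 2 * inner_nabla \<Omega> U U + 2 * inner_nabla \<Omega> V V"
    by (simp add: inner_nabla_eq_sum assms sum.distrib sum_distrib_left)
  finally show ?thesis
    using inner_L2_cdiff_le[OF W21_weak_pd(1)[OF assms(1)] W21_weak_pd(1)[OF assms(2)]]
    by (simp add: inner_12_def)
qed

text \<open>The integrands on the diagonal are squares or sums of squares, so the square root is
  taken of a nonnegative number.\<close>

lemma norm_12_power2: "(norm_12 \<Omega> U)\<^sup>2 = inner_12 \<Omega> U U"
proof -
  have "inner_12 \<Omega> U U \<ge> 0"
    unfolding inner_12_def inner_L2_def inner_nabla_def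
    by (intro add_nonneg_nonneg Bochner_Integration.integral_nonneg sum_nonneg) auto
  then show ?thesis by (simp add: norm_12_def)
qed

text \<open>The crude form of the triangle inequality given by \<open>(a - b)\<^sup>2 \<le> 2a\<^sup>2 + 2b\<^sup>2\<close>.\<close>

lemma norm_12_cdiff_less:
  assumes "U \<in> W21 \<Omega>" "V \<in> W21 \<Omega>" "norm_12 \<Omega> U < e / 2" "norm_12 \<Omega> V < e / 2"
  shows "norm_12 \<Omega> (cdiff \<Omega> U V) < e"
proof -
  have nonneg: "norm_12 \<Omega> W \<ge> 0" for W
    by (metis norm_12_def norm_12_power2 real_sqrt_ge_0_iff zero_le_power2)
  have "(norm_12 \<Omega> (cdiff \<Omega> U V))\<^sup>2 \<le> 2 * (norm_12 \<Omega> U)\<^sup>2 + 2 * (norm_12 \<Omega> V)\<^sup>2"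
    unfolding norm_12_power2 by (rule inner_12_cdiff_le[OF assms(1,2)])
  also have "\<dots> < 2 * (e / 2)\<^sup>2 + 2 * (e / 2)\<^sup>2"
    using assms(3,4) nonneg by (intro add_strict_mono mult_strict_left_mono power_strict_mono) auto
  also have "\<dots> = e\<^sup>2" by (simp add: power2_eq_square)
  finally show ?thesis
    using nonneg[of U] assms(3) by (auto intro: power_less_imp_less_base)
qed

text \<open>Classical derivatives are weak derivatives by integration by parts: the product of two
  test functions is a test function, so its partial derivative integrates to 0, and the product rule
  splits that integral.\<close>

lemma cls_test_function_in_W21:
  assumes \<phi>: "\<phi> \<in> test_functions \<Omega>"
  shows "cls \<Omega> \<phi> \<in> W21 \<Omega>"
proof -
  have L2: "cls \<Omega> \<psi> \<in> L2 \<Omega>" if "\<psi> \<in> test_functions \<Omega>" for \<psi>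
    by (intro cls_in_L2 test_function_sq_integrable that)
  have "is_weak_pd \<Omega> i (cls \<Omega> \<phi>) (cls \<Omega> (pd i \<phi>))" for i
  proof (subst is_weak_pd_iff)
    show "\<forall>\<psi>\<in>test_functions \<Omega>. (LINT x|lebesgue_on \<Omega>. \<phi> x * pd i \<psi> x) =
        - (LINT x|lebesgue_on \<Omega>. pd i \<phi> x * \<psi> x)"
    proof
      fix \<psi> assume \<psi>: "\<psi> \<in> test_functions \<Omega>"
      have "pd i (\<lambda>x. \<phi> x * \<psi> x) = (\<lambda>x. \<phi> x * pd i \<psi> x + pd i \<phi> x * \<psi> x)"
        by (intro ext pd_mult test_functionsD(3)[OF \<phi>] test_functionsD(3)[OF \<psi>])
      then have "(LINT x|lebesgue_on \<Omega>. \<phi> x * pd i \<psi> x + pd i \<phi> x * \<psi> x) = 0"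
        using integral_pd_test_function[OF open_domain test_functions_mult[OF \<phi> \<psi>], of i] by simp
      moreover have "(LINT x|lebesgue_on \<Omega>. \<phi> x * pd i \<psi> x + pd i \<phi> x * \<psi> x) =
          (LINT x|lebesgue_on \<Omega>. \<phi> x * pd i \<psi> x) + (LINT x|lebesgue_on \<Omega>. pd i \<phi> x * \<psi> x)"
        by (intro Bochner_Integration.integral_add sq_integrable_mult test_function_sq_integrable
            test_functions_pd \<phi> \<psi>)
      ultimately show "(LINT x|lebesgue_on \<Omega>. \<phi> x * pd i \<psi> x) = - (LINT x|lebesgue_on \<Omega>. pd i \<phi> x * \<psi> x)"
        by simp
    qed
  qed (intro AE_rep_cls L2 sq_integrable_measurable test_function_sq_integrable test_functions_pd \<phi>)+
  then show ?thesis
    using L2[OF \<phi>] L2[OF test_functions_pd[OF \<phi>]] unfolding W21_def by blast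
qed

section \<open>The subspace \<open>W21_0 \<Omega>\<close> and the admissible sets\<close>

lemma W21_0_in_W21: "U \<in> W21_0 \<Omega> \<Longrightarrow> U \<in> W21 \<Omega>"
  by (simp add: W21_0_def)

text \<open>If \<phi> and \<psi> approximate the two classes within \<open>e / 2\<close>, then
  \<phi> - \<psi> approximates their difference within \<open>e\<close>.\<close>

lemma cdiff_in_W21_0:
  assumes "U \<in> W21_0 \<Omega>" "V \<in> W21_0 \<Omega>"
  shows "cdiff \<Omega> U V \<in> W21_0 \<Omega>"
proof -
  have UV: "U \<in> W21 \<Omega>" "V \<in> W21 \<Omega>" using assms by (auto intro: W21_0_in_W21)
  have "\<exists>\<phi>\<in>test_functions \<Omega>. norm_12 \<Omega> (cdiff \<Omega> (cdiff \<Omega> U V) (cls \<Omega> \<phi>)) < e" if "e > 0" for e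
  proof -
    have "e / 2 > 0" using that by simp
    then obtain \<phi> \<psi> where \<phi>: "\<phi> \<in> test_functions \<Omega>" "norm_12 \<Omega> (cdiff \<Omega> U (cls \<Omega> \<phi>)) < e / 2"
      and \<psi>: "\<psi> \<in> test_functions \<Omega>" "norm_12 \<Omega> (cdiff \<Omega> V (cls \<Omega> \<psi>)) < e / 2"
      using assms unfolding W21_0_def by blast
    note cls = cls_test_function_in_W21[OF \<phi>(1)] cls_test_function_in_W21[OF \<psi>(1)]
    have "cls \<Omega> (\<lambda>x. \<phi> x - \<psi> x) = cdiff \<Omega> (cls \<Omega> \<phi>) (cls \<Omega> \<psi>)"
      using \<phi>(1) \<psi>(1) by (intro cdiff_cls[symmetric] sq_integrable_measurable test_function_sq_integrable)
    then have "cdiff \<Omega> (cdiff \<Omega> U V) (cls \<Omega> (\<lambda>x. \<phi> x - \<psi> x)) =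
        cdiff \<Omega> (cdiff \<Omega> U (cls \<Omega> \<phi>)) (cdiff \<Omega> V (cls \<Omega> \<psi>))"
      by (simp only:) (intro cdiff_cdiff_cdiff W21_weak_pd(1) UV cls)
    moreover have "norm_12 \<Omega> (cdiff \<Omega> (cdiff \<Omega> U (cls \<Omega> \<phi>)) (cdiff \<Omega> V (cls \<Omega> \<psi>))) < e"
      by (intro norm_12_cdiff_less cdiff_in_W21 UV cls \<phi> \<psi>)
    ultimately show ?thesis using test_functions_diff[OF \<phi>(1) \<psi>(1)] by metis
  qed
  then show ?thesis using cdiff_in_W21[OF UV] by (simp add: W21_0_def)
qed

text \<open>W - G and W - H differ by G - H, which lies in \<open>W21_0 \<Omega>\<close>; one
  direction subtracts it and the other adds it.\<close>

lemma cdiff_in_W21_0_iff: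
  assumes "G \<in> W21 \<Omega>" "H \<in> W21 \<Omega>" "W \<in> W21 \<Omega>" and GH: "cdiff \<Omega> G H \<in> W21_0 \<Omega>"
  shows "cdiff \<Omega> W G \<in> W21_0 \<Omega> \<longleftrightarrow> cdiff \<Omega> W H \<in> W21_0 \<Omega>"
proof -
  obtain g h w where cls: "G = cls \<Omega> g" "H = cls \<Omega> h" "W = cls \<Omega> w"
    and "g \<in> sq_integrable \<Omega>" "h \<in> sq_integrable \<Omega>" "w \<in> sq_integrable \<Omega>"
    using assms(1-3)[THEN W21_weak_pd(1)] by (meson L2_cases)
  note [simp] = this(4-6)[THEN sq_integrable_measurable]
  have "cdiff \<Omega> W G = cdiff \<Omega> (cdiff \<Omega> W H) (cdiff \<Omega> G H)"
    by (simp add: cls cdiff_cls borel_measurable_diff)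
  \<comment> \<open>The sum (W - G) + (G - H) is written with differences only, as (W - G) - (0 - (G
    - H)), where G - G stands for 0.\<close>
  moreover have "cdiff \<Omega> W H = cdiff \<Omega> (cdiff \<Omega> W G) (cdiff \<Omega> (cdiff \<Omega> G G) (cdiff \<Omega> G H))"
    by (simp add: cls cdiff_cls borel_measurable_diff)
  \<comment> \<open>This puts the zero class into \<open>W21_0 \<Omega>\<close>, as the difference
    of a member with itself.\<close>
  moreover have "cdiff \<Omega> G G = cdiff \<Omega> (cdiff \<Omega> G H) (cdiff \<Omega> G H)"
    by (simp add: cls cdiff_cls borel_measurable_diff)
  ultimately show ?thesis using GH by (metis cdiff_in_W21_0)
qed

end

theorem mainTheorem3:
  fixes \<Omega> :: "(real^'n::finite) set"
    and f g g' :: "(real^'n \<Rightarrow> real) set"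
  assumes "\<Omega> \<noteq> {}" and "bounded \<Omega>" and "open \<Omega>"
    and "f \<in> L2 \<Omega>" and "g \<in> W21 \<Omega>" and "g' \<in> W21 \<Omega>"
    and "cdiff \<Omega> g g' \<in> W21_0 \<Omega>"
  shows "solution_map \<Omega> f g = solution_map \<Omega> f g'"
proof -
  \<comment> \<open>Once the two admissibility predicates are equal, both solutions are described by
    the same minimization problem.\<close>
  have "(\<lambda>W. W \<in> W21 \<Omega> \<and> cdiff \<Omega> W g \<in> W21_0 \<Omega>) = (\<lambda>W. W \<in> W21 \<Omega> \<and> cdiff \<Omega> W g' \<in> W21_0 \<Omega>)"
    using cdiff_in_W21_0_iff[OF \<open>open \<Omega>\<close> \<open>bounded \<Omega>\<close> \<open>g \<in> W21 \<Omega>\<close> \<open>g' \<in> W21 \<Omega>\<close> _ assms(7)] by blast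
  then show ?thesis by (simp only: solution_map_def)
qed

end
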